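(* Let $p$ be an odd prime and let $k$ be an integer with $1\le k\le p-1$. Let $\Sigma_{p,k}=\sum_{l=1}^{p-2}\frac{B_l}{l\,k^l}$. Let $x_k\in\mathbb{Z}_p$ be the root of $X^{p-1}+(p-1)!$ with $x_k\equiv k\pmod p$. Then $\Sigma_{p,k}\equiv0\pmod p$ if and only if $(x_k)_1=0$.
   Context: $B_l$ are the Bernoulli numbers (with $B_1=-\tfrac12$). The polynomial $X^{p-1}+(p-1)!$ has, for each $k\in\{1,\dots,p-1\}$, exactly one root in $\mathbb{Z}_p$ congruent to $k$ modulo $p$. For a $p$-adic integer $x$, write $x=\sum_{j\ge0}(x)_jp^j$ with digits $(x)_j\in\{0,\dots,p-1\}$, so $(x)_1$ is the second residue in the $p$-adic expansion. *)

theory Defs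
  imports Complex_Main "HOL-Algebra.Ring" "HOL-Computational_Algebra.Primes"
begin

fun bernoulli :: "nat \<Rightarrow> rat" where
  "bernoulli 0 = 1"
| "bernoulli (Suc n) = - (\<Sum>k\<le>n. of_nat (Suc (Suc n) choose k) * bernoulli k) / of_nat (Suc (Suc n))"

lemma bernoulli_1: "bernoulli 1 = - 1 / 2"
  by simp

(* x = y (mod p) in the localization of the integers at p: the difference x - y
   lies in the ideal generated by p. In particular, x = 0 (mod p) means that x is
   p-integral and divisible by p there. *)
definition rat_cong :: "nat \<Rightarrow> rat \<Rightarrow> rat \<Rightarrow> bool" where
  "rat_cong p x y \<longleftrightarrow>
     (\<exists>a b :: int. \<not> int p dvd b \<and> x - y = of_nat p * (of_int a / of_int b))"

(* The p-adic integers as the inverse limit of the rings of integers modulo p^n: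
   x n is the residue of x modulo p^n, represented in {0..<p^n}. *)
definition padic_int :: "nat \<Rightarrow> (nat \<Rightarrow> int) ring" where
  "padic_int p =
     \<lparr> carrier = {x. \<forall>n. x n \<in> {0..<int p ^ n} \<and> x (Suc n) mod int p ^ n = x n},
       monoid.mult = (\<lambda>x y n. (x n * y n) mod int p ^ n),
       one = (\<lambda>n. 1 mod int p ^ n),
       zero = (\<lambda>n. 0),
       add = (\<lambda>x y n. (x n + y n) mod int p ^ n) \<rparr>"

lemma padic_int_cring:
  assumes "p > 0"
  shows "cring (padic_int p)"
proof -
  have pos: "int p ^ n > 0" for n
    using assms by simp
  have range: "x n mod int p ^ n = x n" if "x \<in> carrier (padic_int p)" for x n
    using that by (auto simp: padic_int_def)
  have coh: "m mod int p ^ Suc n mod int p ^ n = m mod int p ^ n" for m n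
    by (simp add: mod_mod_cancel)
  have closed: "(\<lambda>n. f n mod int p ^ n) \<in> carrier (padic_int p)"
    if "\<And>n. f (Suc n) mod int p ^ n = f n mod int p ^ n" for f
    using that pos by (auto simp: padic_int_def coh simp del: power_Suc)
  have step: "x (Suc n) mod int p ^ n = x n mod int p ^ n"
    if "x \<in> carrier (padic_int p)" for x n
    using that by (auto simp: padic_int_def)
  show ?thesis
  proof (intro cringI abelian_groupI comm_monoidI)
    fix x y assume x: "x \<in> carrier (padic_int p)" and y: "y \<in> carrier (padic_int p)"
    show "x \<oplus>\<^bsub>padic_int p\<^esub> y \<in> carrier (padic_int p)"
      using closed[of "\<lambda>n. x n + y n"] mod_add_cong[OF step[OF x] step[OF y]]
      by (simp add: padic_int_def)
    show "x \<otimes>\<^bsub>padic_int p\<^esub> y \<in> carrier (padic_int p)"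
      using closed[of "\<lambda>n. x n * y n"] mod_mult_cong[OF step[OF x] step[OF y]]
      by (simp add: padic_int_def)
    show "x \<oplus>\<^bsub>padic_int p\<^esub> y = y \<oplus>\<^bsub>padic_int p\<^esub> x"
      by (simp add: padic_int_def add.commute)
    show "x \<otimes>\<^bsub>padic_int p\<^esub> y = y \<otimes>\<^bsub>padic_int p\<^esub> x"
      by (simp add: padic_int_def mult.commute)
  next
    show "\<zero>\<^bsub>padic_int p\<^esub> \<in> carrier (padic_int p)"
      using pos by (simp add: padic_int_def)
    show "\<one>\<^bsub>padic_int p\<^esub> \<in> carrier (padic_int p)"
      using closed[of "\<lambda>n. 1"] by (simp add: padic_int_def)
  next
    fix x y z
    show "x \<oplus>\<^bsub>padic_int p\<^esub> y \<oplus>\<^bsub>padic_int p\<^esub> z = x \<oplus>\<^bsub>padic_int p\<^esub> (y \<oplus>\<^bsub>padic_int p\<^esub> z)"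
      by (simp add: padic_int_def mod_simps add.assoc)
    show "x \<otimes>\<^bsub>padic_int p\<^esub> y \<otimes>\<^bsub>padic_int p\<^esub> z = x \<otimes>\<^bsub>padic_int p\<^esub> (y \<otimes>\<^bsub>padic_int p\<^esub> z)"
      by (simp add: padic_int_def mod_simps mult.assoc)
    show "(x \<oplus>\<^bsub>padic_int p\<^esub> y) \<otimes>\<^bsub>padic_int p\<^esub> z =
        x \<otimes>\<^bsub>padic_int p\<^esub> z \<oplus>\<^bsub>padic_int p\<^esub> y \<otimes>\<^bsub>padic_int p\<^esub> z"
      by (simp add: padic_int_def mod_simps distrib_right)
  next
    fix x assume x: "x \<in> carrier (padic_int p)"
    show "\<zero>\<^bsub>padic_int p\<^esub> \<oplus>\<^bsub>padic_int p\<^esub> x = x"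
      using range[OF x] by (simp add: padic_int_def)
    show "\<one>\<^bsub>padic_int p\<^esub> \<otimes>\<^bsub>padic_int p\<^esub> x = x"
      using range[OF x] by (simp add: padic_int_def mod_simps)
    show "\<exists>y\<in>carrier (padic_int p). y \<oplus>\<^bsub>padic_int p\<^esub> x = \<zero>\<^bsub>padic_int p\<^esub>"
    proof
      show "(\<lambda>n. (- x n) mod int p ^ n) \<in> carrier (padic_int p)"
        using closed[of "\<lambda>n. - x n"] mod_minus_cong[OF step[OF x]] by simp
      show "(\<lambda>n. (- x n) mod int p ^ n) \<oplus>\<^bsub>padic_int p\<^esub> x = \<zero>\<^bsub>padic_int p\<^esub>"
        by (simp add: padic_int_def mod_simps)
    qed
  qed
qed

definition padic_cong :: "nat \<Rightarrow> (nat \<Rightarrow> int) \<Rightarrow> (nat \<Rightarrow> int) \<Rightarrow> bool" where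
  "padic_cong p x y \<longleftrightarrow>
     (\<exists>z\<in>carrier (padic_int p).
        x = y \<oplus>\<^bsub>padic_int p\<^esub> ([p] \<cdot>\<^bsub>padic_int p\<^esub> \<one>\<^bsub>padic_int p\<^esub>) \<otimes>\<^bsub>padic_int p\<^esub> z)"

definition padic_digit :: "nat \<Rightarrow> (nat \<Rightarrow> int) \<Rightarrow> nat \<Rightarrow> int" where
  "padic_digit p x j = x (Suc j) div int p ^ j"

lemma padic_digit_range:
  assumes "p > 0" "x \<in> carrier (padic_int p)"
  shows "padic_digit p x j \<in> {0..<int p}"
proof -
  have "\<And>n. x n \<in> {0..<int p ^ n}"
    using assms(2) by (simp add: padic_int_def)
  from this[of "Suc j"] have "0 \<le> x (Suc j)" "x (Suc j) < int p * int p ^ j"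
    by auto
  moreover have "x (Suc j) div int p ^ j * int p ^ j \<le> x (Suc j)"
    using assms(1) by (simp flip: minus_mod_eq_div_mult)
  ultimately have "x (Suc j) div int p ^ j * int p ^ j < int p * int p ^ j"
    by linarith
  then have "x (Suc j) div int p ^ j < int p"
    by (rule mult_right_less_imp_less) simp
  with \<open>0 \<le> x (Suc j)\<close> show ?thesis
    using assms(1) by (simp add: padic_digit_def pos_imp_zdiv_nonneg_iff)
qed

lemma padic_digit_sum:
  assumes "x \<in> carrier (padic_int p)"
  shows "x n = (\<Sum>j<n. padic_digit p x j * int p ^ j)"
proof (induction n)
  case 0
  have "\<And>n. x n \<in> {0..<int p ^ n}"
    using assms by (simp add: padic_int_def)
  from this[of 0] have "x 0 = 0" by simp
  then show ?case by simp
next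
  case (Suc n)
  have "x (Suc n) mod int p ^ n = x n"
    using assms by (simp add: padic_int_def)
  then have "x (Suc n) = x n + padic_digit p x n * int p ^ n"
    unfolding padic_digit_def by (metis add.commute div_mult_mod_eq)
  with Suc show ?case by simp
qed

end

(* Let S(m) = sum_{j<m} j^(p-1).  Faulhaber's formula expresses p S(m) through the
   terms C(p,l) B_l m^(p-l).  For m = p it gives, modulo p^2, p B_(p-1) = S(p), and S(p) = p + (p-1)!
   follows by expanding the product of the j^(p-1) to first order in p around 1 and
   applying Wilson's theorem.  For m = p - k, Fermat's theorem gives S(m) = m - 1 mod p,
   while C(p,l) = p (-1)^(l-1) / l mod p^2 turns the terms 1 <= l <= p-2 into
   p k B_l / (l k^l); the sign disappears because m = -k.  Comparing, p k Sigma = k^p + k (p-1)! mod p^2,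
   so Sigma vanishes mod p iff k is a root of X^(p-1) + (p-1)! mod p^2.  As the
   derivative is a unit at k, this means that the root x is k mod p^2. *)
theory Submission
  imports Defs "HOL-Number_Theory.Residues"
begin

section \<open>Bernoulli numbers and power sums\<close>

text \<open>The defining recursion cleared of its denominator: the coefficient of the last summand
  is \<open>n choose (n - 1) = n\<close>. For \<open>n = 1\<close> only
  \<open>bernoulli 0 = 1\<close> remains.\<close>

lemma sum_choose_bernoulli:
  "(\<Sum>l<n. of_nat (n choose l) * bernoulli l) = (if n = 1 then 1 else 0)"
proof (cases n rule: bernoulli.cases)
  case 1
  then show ?thesis by simp
next
  case (2 m)
  show ?thesis
  proof (cases m)
    case 0
    with 2 show ?thesis by simp
  next
    case (Suc r)
    have "of_nat (Suc (Suc r)) * bernoulli (Suc r)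
        = - (\<Sum>k\<le>r. of_nat (Suc (Suc r) choose k) * bernoulli k)"
      by (simp only: bernoulli.simps times_divide_eq_right nonzero_mult_div_cancel_left
          of_nat_eq_0_iff nat.simps not_False_eq_True)
    moreover have "Suc (Suc r) choose Suc r = Suc (Suc r)"
      using binomial_symmetric[of "Suc r" "Suc (Suc r)"] by simp
    ultimately show ?thesis
      using 2 Suc by (simp only: lessThan_Suc_atMost sum.atMost_Suc) simp
  qed
qed

definition bernoulli_poly :: "nat \<Rightarrow> rat \<Rightarrow> rat" where
  "bernoulli_poly n x = (\<Sum>l\<le>n. of_nat (n choose l) * bernoulli l * x ^ (n - l))"

text \<open>After expanding \<open>(x + 1) ^ (n - l)\<close> and swapping sums, the coefficient of
  \<open>x ^ i\<close> contains the recursion sum for \<open>n - i\<close>. It reproduces the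
  polynomial, and the exceptional case \<open>n - i = 1\<close> contributes the right-hand
  side.\<close>

lemma bernoulli_poly_diff:
  "bernoulli_poly n (x + 1) - bernoulli_poly n x = of_nat n * x ^ (n - 1)"
proof -
  \<comment> \<open>The range of \<open>i\<close> is padded with vanishing binomials so that it no
    longer depends on \<open>l\<close> and the sums can be swapped.\<close>
  have pow: "(x + 1) ^ (n - l) = (\<Sum>i\<le>n. of_nat ((n - l) choose i) * x ^ i)" for l
  proof -
    have "(x + 1) ^ (n - l) = (\<Sum>i\<le>n - l. of_nat ((n - l) choose i) * x ^ i)"
      by (simp add: binomial_ring)
    also have "\<dots> = (\<Sum>i\<le>n. of_nat ((n - l) choose i) * x ^ i)"
      by (rule sum.mono_neutral_left) auto
    finally show ?thesis .
  qed
  \<comment> \<open>Both sides count pairs of disjoint subsets of sizes \<open>l\<close> and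
    \<open>i\<close>; for \<open>l + i > n\<close> both are zero.\<close>
  have choose: "(n choose l) * ((n - l) choose i) = (n choose i) * ((n - i) choose l)"
    if "l \<le> n" "i \<le> n" for l i
  proof (cases "l + i \<le> n")
    case True
    have "(n choose (l + i)) * ((l + i) choose l) = (n choose l) * ((n - l) choose i)"
      using choose_mult[of l "l + i" n] True by simp
    moreover have "(n choose (l + i)) * ((l + i) choose i) = (n choose i) * ((n - i) choose l)"
      using choose_mult[of i "l + i" n] True by simp
    moreover have "(l + i) choose l = (l + i) choose i"
      using binomial_symmetric[of l "l + i"] by simp
    ultimately show ?thesis by simp
  next
    case False
    then show ?thesis
      using that by (simp add: binomial_eq_0 not_le less_diff_conv2 add.commute)
  qed
  have inner: "(\<Sum>l\<le>n. of_nat ((n - i) choose l) * bernoulli l)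
      = bernoulli (n - i) + (if n - i = 1 then 1 else 0)" if "i \<le> n" for i
  proof -
    have "(\<Sum>l\<le>n. of_nat ((n - i) choose l) * bernoulli l)
        = (\<Sum>l\<le>n - i. of_nat ((n - i) choose l) * bernoulli l)"
      by (rule sum.mono_neutral_right) auto
    also have "\<dots> = (\<Sum>l<n - i. of_nat ((n - i) choose l) * bernoulli l) + bernoulli (n - i)"
      by (simp flip: lessThan_Suc_atMost)
    finally show ?thesis
      by (simp add: sum_choose_bernoulli)
  qed
  have "bernoulli_poly n (x + 1)
      = (\<Sum>l\<le>n. \<Sum>i\<le>n. of_nat ((n choose l) * ((n - l) choose i)) * bernoulli l * x ^ i)"
    by (simp add: bernoulli_poly_def pow sum_distrib_left mult_ac)
  also have "\<dots> = (\<Sum>l\<le>n. \<Sum>i\<le>n. of_nat ((n choose i) * ((n - i) choose l)) * bernoulli l * x ^ i)"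
    by (intro sum.cong refl) (simp only: choose atMost_iff)
  also have "\<dots> = (\<Sum>i\<le>n. \<Sum>l\<le>n. of_nat ((n choose i) * ((n - i) choose l)) * bernoulli l * x ^ i)"
    by (rule sum.swap)
  also have "\<dots> = (\<Sum>i\<le>n. of_nat (n choose i) * x ^ i * (\<Sum>l\<le>n. of_nat ((n - i) choose l) * bernoulli l))"
    by (simp add: sum_distrib_left mult_ac)
  also have "\<dots> = (\<Sum>i\<le>n. of_nat (n choose i) * x ^ i * bernoulli (n - i))
      + (\<Sum>i\<le>n. if n - i = 1 then of_nat (n choose i) * x ^ i else 0)"
    unfolding sum.distrib[symmetric] by (intro sum.cong refl) (simp add: inner distrib_left)
  also have "(\<Sum>i\<le>n. of_nat (n choose i) * x ^ i * bernoulli (n - i)) = bernoulli_poly n x"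
    unfolding bernoulli_poly_def
    by (rule sum.reindex_bij_witness[of _ "\<lambda>i. n - i" "\<lambda>i. n - i"])
      (auto simp: mult_ac binomial_symmetric[symmetric])
  also have "(\<Sum>i\<le>n. if n - i = 1 then of_nat (n choose i) * x ^ i else 0) = of_nat n * x ^ (n - 1)"
  proof (cases n)
    case (Suc m)
    have "(\<Sum>i\<le>n. if n - i = 1 then of_nat (n choose i) * x ^ i else 0)
        = (\<Sum>i\<le>n. if i = m then of_nat (n choose i) * x ^ i else 0)"
      by (intro sum.cong) (auto simp: Suc)
    then show ?thesis
      using Suc binomial_symmetric[of m "Suc m"] by simp
  qed simp
  finally show ?thesis by simp
qed

text \<open>Faulhaber's formula, by telescoping the difference equation; the value at 0 cancels the
  summand \<open>l = n\<close>.\<close>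

lemma sum_powers_bernoulli:
  assumes "n > 0"
  shows "of_nat n * (\<Sum>j<m. of_nat j ^ (n - 1))
    = (\<Sum>l<n. of_nat (n choose l) * bernoulli l * of_nat m ^ (n - l))"
proof -
  have "of_nat n * (\<Sum>j<m. of_nat j ^ (n - 1)) = bernoulli_poly n (of_nat m) - bernoulli_poly n 0"
  proof (induction m)
    case (Suc m)
    then show ?case
      using bernoulli_poly_diff[of n "of_nat m"] by (simp add: distrib_left add.commute)
  qed simp
  moreover have "bernoulli_poly n 0 = bernoulli n"
  proof -
    have "bernoulli_poly n 0 = (\<Sum>l\<le>n. if l = n then bernoulli n else 0)"
      unfolding bernoulli_poly_def by (intro sum.cong refl) (auto simp: power_0_left)
    then show ?thesis by simp
  qed
  ultimately show ?thesis
    by (simp add: bernoulli_poly_def flip: lessThan_Suc_atMost)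
qed

section \<open>Divisibility in the localization at a prime\<close>

text \<open>Divisibility by \<open>p ^ n\<close> in the ring of rationals with denominator prime to \<open>p\<close>;
  for \<open>n = 0\<close> it expresses \<open>p\<close>-integrality.\<close>

definition local_dvd :: "nat \<Rightarrow> nat \<Rightarrow> rat \<Rightarrow> bool" where
  "local_dvd p n x \<longleftrightarrow> (\<exists>a b :: int. \<not> int p dvd b \<and> x = of_nat p ^ n * (of_int a / of_int b))"

lemma rat_cong_0_iff: "rat_cong p x 0 \<longleftrightarrow> local_dvd p 1 x"
  by (simp add: rat_cong_def local_dvd_def)

locale prime_nat =
  fixes p :: nat
  assumes prime: "prime p"
begin

lemma prime_int: "prime (int p)"
  using prime by simp

lemma p_gt_1: "p > 1"
  by (rule prime_gt_1_nat[OF prime])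

lemma local_dvd_0 [simp]: "local_dvd p n 0"
  unfolding local_dvd_def using p_gt_1 by (intro exI[of _ 0] exI[of _ 1]) simp

lemma local_dvd_add:
  assumes "local_dvd p n x" "local_dvd p n y"
  shows "local_dvd p n (x + y)"
proof -
  from assms obtain a b c d where
    "\<not> int p dvd b" "x = of_nat p ^ n * (of_int a / of_int b)"
    "\<not> int p dvd d" "y = of_nat p ^ n * (of_int c / of_int d)"
    unfolding local_dvd_def by blast
  moreover from this have "\<not> int p dvd b * d" "b \<noteq> 0" "d \<noteq> 0"
    using prime_int by (auto simp: prime_dvd_mult_iff)
  ultimately have "x + y = of_nat p ^ n * (of_int (a * d + c * b) / of_int (b * d))"
    by (simp add: field_simps)
  with \<open>\<not> int p dvd b * d\<close> show ?thesis
    unfolding local_dvd_def by blast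
qed

lemma local_dvd_mult:
  assumes "local_dvd p m x" "local_dvd p n y"
  shows "local_dvd p (m + n) (x * y)"
proof -
  from assms obtain a b c d where
    "\<not> int p dvd b" "x = of_nat p ^ m * (of_int a / of_int b)"
    "\<not> int p dvd d" "y = of_nat p ^ n * (of_int c / of_int d)"
    unfolding local_dvd_def by blast
  moreover from this have "\<not> int p dvd b * d"
    using prime_int by (auto simp: prime_dvd_mult_iff)
  ultimately show ?thesis
    unfolding local_dvd_def
    by (intro exI[of _ "a * c"] exI[of _ "b * d"]) (simp add: power_add mult_ac)
qed

text \<open>Denominators are coprime to \<open>p ^ n\<close>, so clearing them loses nothing. This
  moves integer congruences into the localization and back.\<close>

lemma local_dvd_of_int_iff: "local_dvd p n (of_int a) \<longleftrightarrow> int p ^ n dvd a"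
proof
  assume "local_dvd p n (of_int a)"
  then obtain c d where d: "\<not> int p dvd d" and "(of_int a :: rat) = of_nat p ^ n * (of_int c / of_int d)"
    unfolding local_dvd_def by blast
  moreover from d have "d \<noteq> 0" by auto
  ultimately have "(of_int (a * d) :: rat) = of_int (int p ^ n * c)"
    by (simp add: field_simps)
  then have "int p ^ n dvd a * d"
    by (simp only: of_int_eq_iff dvd_triv_left)
  moreover have "coprime (int p ^ n) d"
    using d prime_int by (simp add: prime_imp_coprime coprime_power_left_iff)
  ultimately show "int p ^ n dvd a"
    by (simp add: coprime_dvd_mult_left_iff)
next
  assume "int p ^ n dvd a"
  then obtain c where "a = int p ^ n * c" ..
  then show "local_dvd p n (of_int a)"
    unfolding local_dvd_def using p_gt_1 by (intro exI[of _ c] exI[of _ 1]) simp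
qed

lemma local_dvd_minus: "local_dvd p n x \<Longrightarrow> local_dvd p n (- x)"
  using local_dvd_mult[of 0 "of_int (- 1)" n x] by (simp only: local_dvd_of_int_iff) simp

lemma local_dvd_diff: "local_dvd p n x \<Longrightarrow> local_dvd p n y \<Longrightarrow> local_dvd p n (x - y)"
  using local_dvd_add[of n x "- y"] local_dvd_minus by simp

lemma local_dvd_sum: "(\<And>i. i \<in> A \<Longrightarrow> local_dvd p n (f i)) \<Longrightarrow> local_dvd p n (sum f A)"
  by (induction A rule: infinite_finite_induct) (auto intro: local_dvd_add)

lemma local_dvd_inverse:
  assumes "\<not> p dvd m"
  shows "local_dvd p 0 (1 / of_nat m)"
  unfolding local_dvd_def using assms by (intro exI[of _ 1] exI[of _ "int m"]) simp

lemma local_dvd_mult_p_cancel: "local_dvd p (Suc n) (of_nat p * x) \<longleftrightarrow> local_dvd p n x"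
proof -
  have "of_nat p * x = of_nat p ^ Suc n * y \<longleftrightarrow> x = of_nat p ^ n * y" for y :: rat
    using p_gt_1 by (simp add: mult.assoc)
  then show ?thesis unfolding local_dvd_def by (simp only:)
qed

lemma local_dvd_mult_unit_cancel:
  assumes "\<not> p dvd m" "local_dvd p n (of_nat m * x)"
  shows "local_dvd p n x"
proof -
  have "m \<noteq> 0" using assms(1) by (intro notI) simp
  then show ?thesis
    using local_dvd_mult[OF local_dvd_inverse[OF assms(1)] assms(2)] by simp
qed

text \<open>The recursion for \<open>bernoulli l\<close> divides only by \<open>l + 1\<close>, a
  unit at \<open>p\<close> as long as \<open>l + 1 < p\<close>.\<close>

lemma local_dvd_bernoulli: "Suc l < p \<Longrightarrow> local_dvd p 0 (bernoulli l)"
proof (induction l rule: less_induct)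
  case (less l)
  show ?case
  proof (cases l)
    case 0
    then show ?thesis using local_dvd_of_int_iff[of 0 1] by simp
  next
    case (Suc n)
    have "local_dvd p (0 + 0) (of_int (int (Suc (Suc n) choose k)) * bernoulli k)" if "k \<le> n" for k
      using that Suc less by (intro local_dvd_mult) (auto simp only: local_dvd_of_int_iff power_0 one_dvd)
    then have "local_dvd p 0 (- (\<Sum>k\<le>n. of_nat (Suc (Suc n) choose k) * bernoulli k))"
      by (intro local_dvd_minus local_dvd_sum) simp
    moreover have "\<not> p dvd Suc (Suc n)"
      using less.prems Suc by (auto dest: dvd_imp_le)
    ultimately show ?thesis
      using local_dvd_mult[OF _ local_dvd_inverse, of 0 _ "Suc (Suc n)"] Suc
      by (simp only: bernoulli.simps times_divide_eq_right mult_1_right add_0 simp_thms)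
  qed
qed

end

section \<open>Congruences modulo the square of a prime\<close>

text \<open>Taylor expansion to first order. At \<open>n = 0\<close> the truncated exponent is
  harmless because its coefficient is 0.\<close>

lemma power_add_mult_cong_square:
  fixes a q t :: int
  shows "[(a + q * t) ^ n = a ^ n + of_nat n * a ^ (n - 1) * (q * t)] (mod q ^ 2)"
proof (induction n)
  case (Suc n)
  have "[(a + q * t) * (a + q * t) ^ n
      = (a + q * t) * (a ^ n + of_nat n * a ^ (n - 1) * (q * t))] (mod q ^ 2)"
    by (intro cong_mult cong_refl Suc)
  also have "(a + q * t) * (a ^ n + of_nat n * a ^ (n - 1) * (q * t))
      = a ^ Suc n + of_nat (Suc n) * a ^ n * (q * t) + q ^ 2 * (t ^ 2 * of_nat n * a ^ (n - 1))"
    by (cases n) (simp_all add: algebra_simps power2_eq_square)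
  also have "[\<dots> = a ^ Suc n + of_nat (Suc n) * a ^ n * (q * t)] (mod q ^ 2)"
    by (simp add: cong_iff_dvd_diff)
  finally show ?case by simp
qed simp

text \<open>Each factor is 1 plus a multiple of \<open>q\<close>, and the product of two such
  multiples vanishes modulo \<open>q ^ 2\<close>.\<close>

lemma prod_cong_1_square:
  fixes q :: int
  assumes "\<And>i. i \<in> A \<Longrightarrow> [f i = 1] (mod q)"
  shows "[prod f A = 1 + (\<Sum>i\<in>A. f i - 1)] (mod q ^ 2)"
  using assms
proof (induction A rule: infinite_finite_induct)
  case (insert a A)
  let ?S = "\<Sum>i\<in>A. f i - 1"
  have "[f a * prod f A = f a * (1 + ?S)] (mod q ^ 2)"
    using insert by (intro cong_mult cong_refl) auto
  also have "[f a * (1 + ?S) = 1 + ((f a - 1) + ?S)] (mod q ^ 2)"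
  proof -
    have "q dvd f a - 1" "q dvd ?S"
      using insert.prems by (auto intro!: dvd_sum simp: cong_iff_dvd_diff)
    then have "q * q dvd (f a - 1) * ?S"
      by (rule mult_dvd_mono)
    then show ?thesis
      by (simp add: cong_iff_dvd_diff power2_eq_square algebra_simps)
  qed
  finally show ?case using insert.hyps by simp
qed simp_all

context prime_nat
begin

lemma fermat_int: "\<not> p dvd j \<Longrightarrow> [int j ^ (p - 1) = 1] (mod int p)"
  using fermat_theorem[OF prime] by (metis cong_int_iff of_nat_1 of_nat_power)

lemma sum_powers_cong_square:
  assumes "odd p"
  shows "[(\<Sum>j<p. int j ^ (p - 1)) = int p + fact (p - 1)] (mod int p ^ 2)"
proof -
  define S where "S = (\<Sum>j<p. int j ^ (p - 1))"
  have S: "S = (\<Sum>j=1..p - 1. int j ^ (p - 1))"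
    unfolding S_def using p_gt_1
    by (intro sum.mono_neutral_right) (auto simp: not_le)
  have "[fact (p - 1) = (- 1 :: int)] (mod int p)"
    using wilson_theorem[OF prime] by simp
  \<comment> \<open>\<open>w\<close> is the Wilson quotient; the product of the
    \<open>j ^ (p - 1)\<close> is now computed once through it and once by
    \<open>prod_cong_1_square\<close>.\<close>
  then obtain w where w: "fact (p - 1) = (- 1 :: int) + int p * w"
    by (metis add.commute cong_iff_lin mult.commute cong_sym)
  have "(\<Prod>j=1..p - 1. int j ^ (p - 1)) = fact (p - 1) ^ (p - 1)"
    by (simp add: fact_prod prod_power_distrib)
  also have "[\<dots> = (- 1) ^ (p - 1) + of_nat (p - 1) * (- 1) ^ (p - 1 - 1) * (int p * w)] (mod int p ^ 2)"
    unfolding w by (rule power_add_mult_cong_square)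
  also have "(- 1) ^ (p - 1) + of_nat (p - 1) * (- 1) ^ (p - 1 - 1) * (int p * w)
      = 1 - (int p - 1) * (int p * w)"
  proof -
    have "even (p - 1)" "odd (p - 1 - 1)"
      using \<open>odd p\<close> p_gt_1 by presburger+
    then show ?thesis
      using p_gt_1 by (simp add: of_nat_diff algebra_simps)
  qed
  \<comment> \<open>Modulo \<open>p ^ 2\<close> the left side is \<open>1 + p * w\<close>, and
    \<open>p * w = 1 + fact (p - 1)\<close>.\<close>
  also have "[\<dots> = 2 + fact (p - 1)] (mod int p ^ 2)"
    unfolding w by (simp add: cong_iff_dvd_diff power2_eq_square algebra_simps)
  finally have fact: "[(\<Prod>j=1..p - 1. int j ^ (p - 1)) = 2 + fact (p - 1)] (mod int p ^ 2)" .
  have sum: "[(\<Prod>j=1..p - 1. int j ^ (p - 1)) = 1 + (\<Sum>j=1..p - 1. int j ^ (p - 1) - 1)] (mod int p ^ 2)"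
    by (intro prod_cong_1_square fermat_int) (auto dest!: dvd_imp_le)
  have "(\<Sum>j=1..p - 1. int j ^ (p - 1) - 1) = S - (int p - 1)"
    using p_gt_1 by (simp add: S sum_subtractf)
  with cong_trans[OF cong_sym[OF sum] fact]
  have "[1 + (S - (int p - 1)) = 2 + fact (p - 1)] (mod int p ^ 2)"
    by (simp only:)
  then show ?thesis
    unfolding S_def[symmetric] by (simp add: cong_iff_dvd_diff algebra_simps)
qed

text \<open>By Pascal's rule neighbouring entries of row \<open>p - 1\<close> add up to an entry of
  row \<open>p\<close> that is divisible by \<open>p\<close>, so the sign alternates.\<close>

lemma choose_pred_cong:
  assumes "j < p"
  shows "[int ((p - 1) choose j) = (- 1) ^ j] (mod int p)"
  using assms
proof (induction j)
  case (Suc j)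
  have "Suc (p - 1) choose Suc j = ((p - 1) choose j) + ((p - 1) choose Suc j)"
    by (rule binomial_Suc_Suc)
  moreover have "p dvd (p choose Suc j)"
    using Suc.prems prime by (intro dvd_choose_prime) auto
  ultimately have "int p dvd int ((p - 1) choose j) + int ((p - 1) choose Suc j)"
    using p_gt_1 by (simp flip: of_nat_add)
  moreover have "int p dvd int ((p - 1) choose j) - (- 1) ^ j"
    using Suc by (simp add: cong_iff_dvd_diff)
  ultimately have "int p dvd (int ((p - 1) choose j) + int ((p - 1) choose Suc j)) - (int ((p - 1) choose j) - (- 1) ^ j)"
    by (rule dvd_diff)
  then show ?case by (simp add: cong_iff_dvd_diff)
qed simp

section \<open>Faulhaber's formula for the exponent \<open>p - 1\<close>, modulo
  \<open>p ^ 2\<close>\<close>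

lemma choose_eq_pred:
  assumes "l > 0"
  shows "(of_nat (p choose l) :: rat) = of_nat p * of_nat ((p - 1) choose (l - 1)) / of_nat l"
proof -
  have "l * (p choose l) = p * ((p - 1) choose (l - 1))"
    using assms by (rule times_binomial_minus1_eq)
  then have "(of_nat l * of_nat (p choose l) :: rat) = of_nat p * of_nat ((p - 1) choose (l - 1))"
    by (simp flip: of_nat_mult)
  then show ?thesis using assms by (simp add: field_simps)
qed

text \<open>The summands \<open>l = 0\<close> and \<open>l = p - 1\<close> are split off: in the
  remaining ones \<open>p\<close> divides the binomial and \<open>local_dvd_bernoulli\<close>
  applies.\<close>

lemma sum_powers_bernoulli_prime:
  "of_nat p * (\<Sum>j<m. of_nat j ^ (p - 1))
    = of_nat m ^ p + (\<Sum>l=1..p - 2. of_nat (p choose l) * bernoulli l * of_nat m ^ (p - l))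
      + of_nat p * bernoulli (p - 1) * of_nat m"
proof -
  have "{..<p} = insert 0 (insert (p - 1) {1..p - 2})"
    using p_gt_1 by auto
  moreover have "p - 1 \<notin> {1..p - 2}" "0 \<notin> insert (p - 1) {1..p - 2}"
    using p_gt_1 by auto
  moreover have "p choose (p - 1) = p"
    using binomial_symmetric[of 1 p] p_gt_1 by simp
  ultimately show ?thesis
    using sum_powers_bernoulli[of p m] p_gt_1
    by (simp only: finite_insert finite_atLeastAtMost sum.insert) simp
qed

text \<open>Faulhaber at \<open>m = p\<close>: a middle term gets one \<open>p\<close> from the
  binomial and at least two from \<open>p ^ (p - l)\<close>, and \<open>p ^ p\<close> is covered by
  \<open>p \<ge> 3\<close>. Cancelling one \<open>p\<close> from the formula modulo
  \<open>p ^ 3\<close> leaves the power sum, known modulo \<open>p ^ 2\<close>.\<close>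

lemma local_dvd_bernoulli_pred:
  assumes "odd p"
  shows "local_dvd p 2 (of_nat p * bernoulli (p - 1) - of_int (int p + fact (p - 1)))"
proof -
  have p3: "p \<ge> 3"
    using assms p_gt_1 by presburger
  let ?S = "\<Sum>j<p. int j ^ (p - 1)"
  let ?T = "\<lambda>l. of_nat (p choose l) * bernoulli l * of_nat p ^ (p - l)"
  have "local_dvd p 3 (?T l)" if l: "l \<in> {1..p - 2}" for l
  proof -
    have "local_dvd p (0 + 0) (1 / of_nat l * bernoulli l)"
      using l by (intro local_dvd_mult local_dvd_inverse local_dvd_bernoulli) (auto dest!: dvd_imp_le)
    moreover have "int p ^ 2 dvd int p ^ (p - l)"
      using l by (intro le_imp_power_dvd) auto
    then have "local_dvd p 3 (of_int (int p * int ((p - 1) choose (l - 1)) * int p ^ (p - l)))"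
      unfolding local_dvd_of_int_iff
      by (simp add: numeral_3_eq_3 power2_eq_square mult.assoc mult_dvd_mono dvd_mult)
    ultimately have "local_dvd p (0 + 0 + 3) (1 / of_nat l * bernoulli l *
        of_int (int p * int ((p - 1) choose (l - 1)) * int p ^ (p - l)))"
      by (rule local_dvd_mult)
    then show ?thesis
      using l by (simp add: choose_eq_pred mult_ac)
  qed
  then have "local_dvd p 3 (of_int (int p ^ p) + (\<Sum>l=1..p - 2. ?T l))"
    using p3 by (intro local_dvd_add local_dvd_sum) (auto simp only: local_dvd_of_int_iff intro: le_imp_power_dvd)
  also have "of_int (int p ^ p) + (\<Sum>l=1..p - 2. ?T l)
      = of_nat p * (of_int ?S - of_nat p * bernoulli (p - 1))"
    using sum_powers_bernoulli_prime[of p] by (simp add: algebra_simps)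
  finally have "local_dvd p 2 (of_int ?S - of_nat p * bernoulli (p - 1))"
    by (simp only: numeral_3_eq_3 numeral_2_eq_2 local_dvd_mult_p_cancel)
  moreover have "local_dvd p 2 (of_int (?S - (int p + fact (p - 1))))"
    using sum_powers_cong_square[OF assms] by (simp only: local_dvd_of_int_iff cong_iff_dvd_diff)
  ultimately have "local_dvd p 2 (of_int (?S - (int p + fact (p - 1))) - (of_int ?S - of_nat p * bernoulli (p - 1)))"
    by (rule local_dvd_diff[rotated])
  then show ?thesis by (simp add: algebra_simps)
qed

lemma local_dvd_sum_bernoulli:
  fixes k :: nat
  defines "\<Sigma> \<equiv> \<Sum>l=1..p - 2. bernoulli l / (of_nat l * of_nat k ^ l)"
  assumes "odd p" "1 \<le> k" "k \<le> p - 1"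
  shows "local_dvd p 2 (of_nat p * (of_nat k * \<Sigma>) - of_int (int k ^ p + int k * fact (p - 1)))"
proof -
  define m where "m = p - k"
  have m: "int m = int p - int k" "0 < m" "m < p"
    using assms p_gt_1 by (auto simp: m_def)
  have not_dvd_k: "\<not> p dvd k"
    using assms p_gt_1 by (auto dest!: dvd_imp_le)
  have m_cong: "[int m = - int k] (mod int p)"
    by (simp add: m cong_iff_dvd_diff)
  let ?T = "\<lambda>l. of_nat (p choose l) * bernoulli l * of_nat m ^ (p - l)"
  let ?U = "\<lambda>l. of_nat p * (of_nat k * (bernoulli l / (of_nat l * of_nat k ^ l)))"
  have T_U: "local_dvd p 2 (?T l - ?U l)" if l: "l \<in> {1..p - 2}" for l
  proof -
    \<comment> \<open>Chosen so that \<open>?T l - ?U l\<close> equals \<open>p * (?c - k)\<close>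
      times the \<open>p\<close>-integral number \<open>bernoulli l / (l * k ^ l)\<close>; hence
      \<open>?c = k\<close> is needed only modulo \<open>p\<close>.\<close>
    let ?c = "int ((p - 1) choose (l - 1)) * int m ^ (p - l) * int k ^ l"
    have "[?c = (- 1) ^ (l - 1) * (- int k) ^ (p - l) * int k ^ l] (mod int p)"
      using l m_cong by (intro cong_mult cong_pow choose_pred_cong) auto
    also have "(- 1) ^ (l - 1) * (- int k) ^ (p - l) * int k ^ l = int k ^ p"
    proof -
      have "l - 1 + (p - l) = p - 1" using l by auto
      then have "(- 1 :: int) ^ (l - 1) * (- 1) ^ (p - l) = (- 1) ^ (p - 1)"
        by (simp only: flip: power_add)
      then have "(- 1 :: int) ^ (l - 1) * (- 1) ^ (p - l) = 1"
        using assms by simp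
      moreover have "int k ^ (p - l) * int k ^ l = int k ^ p"
      proof -
        have "p - l + l = p" using l by auto
        then show ?thesis by (simp only: flip: power_add)
      qed
      moreover have "(- int k) ^ (p - l) = (- 1) ^ (p - l) * int k ^ (p - l)"
        by (rule power_minus)
      ultimately show ?thesis by (metis mult.assoc mult_1)
    qed
    also have "int k ^ p = int k ^ (p - 1) * int k"
      using p_gt_1 by (cases p) auto
    also have "[\<dots> = 1 * int k] (mod int p)"
      by (intro cong_mult cong_refl fermat_int not_dvd_k)
    finally have "int p ^ 2 dvd int p * (?c - int k)"
      by (simp add: cong_iff_dvd_diff power2_eq_square)
    then have "local_dvd p 2 (of_int (int p * (?c - int k)))"
      by (simp only: local_dvd_of_int_iff)
    moreover have "local_dvd p (0 + (0 + 0)) (bernoulli l * ((1 / of_nat l) * (1 / of_nat (k ^ l))))"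
      using l not_dvd_k
      by (intro local_dvd_mult local_dvd_inverse local_dvd_bernoulli)
        (auto dest!: dvd_imp_le simp: prime_dvd_power_iff[OF prime])
    ultimately have "local_dvd p (0 + (0 + 0) + 2) (bernoulli l * ((1 / of_nat l) * (1 / of_nat (k ^ l)))
        * of_int (int p * (?c - int k)))"
      by (rule local_dvd_mult[rotated])
    also have "bernoulli l * ((1 / of_nat l) * (1 / of_nat (k ^ l))) * of_int (int p * (?c - int k))
        = ?T l - ?U l"
    proof -
      \<comment> \<open>The identity is checked in independent rational variables and instantiated
        with the powers and binomials afterwards.\<close>
      have "B * ((1 / L) * (1 / K)) * (P * (C * M * K - k')) = P * C / L * B * M - P * (k' * (B / (L * K)))"
        if "L \<noteq> 0" "K \<noteq> 0" for B L K P C M k' :: rat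
        using that by (simp add: field_simps)
      from this[of "of_nat l" "of_nat k ^ l"] show ?thesis
        using l assms(3) by (simp add: choose_eq_pred)
    qed
    finally show ?thesis by (simp only: add_0)
  qed
  define A where "A = (\<Sum>j<m. int j ^ (p - 1))"
  define D where "D = of_nat p * bernoulli (p - 1) - of_int (int p + fact (p - 1))"
  \<comment> \<open>The term \<open>j = 0\<close> vanishes and the other \<open>m - 1\<close> terms
    are 1 by Fermat.\<close>
  have "[A = int m - 1] (mod int p)"
  proof -
    have "A = (\<Sum>j\<in>{1..<m}. int j ^ (p - 1))"
      unfolding A_def using p_gt_1 by (intro sum.mono_neutral_right) (auto simp: not_le)
    also have "[\<dots> = (\<Sum>j\<in>{1..<m}. 1)] (mod int p)"
      using m by (intro cong_sum fermat_int) (auto dest!: dvd_imp_le)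
    finally show ?thesis using m(2) by (simp add: of_nat_diff)
  qed
  then have A: "int p ^ 2 dvd int p * (A - (int m - 1))"
    by (simp add: cong_iff_dvd_diff power2_eq_square)
  have m_pow: "int p ^ 2 dvd int m ^ p + int k ^ p"
  proof -
    \<comment> \<open>This is the first-order term of \<open>(- k + p) ^ p\<close>: the exponent
      supplies the second factor \<open>p\<close>.\<close>
    let ?r = "int p ^ 2 * (- int k) ^ (p - 1)"
    have "int p ^ 2 dvd int m ^ p + int k ^ p - ?r"
      using power_add_mult_cong_square[of "- int k" "int p" 1 p] \<open>odd p\<close>
      by (simp add: m cong_iff_dvd_diff power2_eq_square algebra_simps)
    from dvd_add[OF this dvd_triv_left[of "int p ^ 2" "(- int k) ^ (p - 1)"]] show ?thesis
      by simp
  qed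
  have "int p dvd 1 + fact (p - 1)"
    using wilson_theorem[OF prime] by (simp add: cong_iff_dvd_diff add.commute)
  then have fact: "int p ^ 2 dvd int p * (1 + fact (p - 1))"
    by (simp add: power2_eq_square)
  have T_sum: "of_nat p * of_int A = of_nat m ^ p + (\<Sum>l=1..p - 2. ?T l)
      + of_nat p * bernoulli (p - 1) * of_nat m"
    using sum_powers_bernoulli_prime[of m] by (simp add: A_def)
  have U_sum: "of_nat p * (of_nat k * \<Sigma>) = (\<Sum>l=1..p - 2. ?U l)"
    by (simp only: \<Sigma>_def sum_distrib_left)
  \<comment> \<open>\<open>?E\<close> combines the consequences of Fermat, of \<open>m = - k\<close>
    and of Wilson. Removing \<open>m * D\<close> and the differences \<open>?T l - ?U l\<close>
    leaves exactly the claimed expression.\<close>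
  let ?E = "int p * (A - (int m - 1)) - (int m ^ p + int k ^ p) - int p * (1 + fact (p - 1))"
  have "local_dvd p 2 (of_int ?E - of_int (int m) * D - (\<Sum>l=1..p - 2. ?T l - ?U l))"
  proof (rule local_dvd_diff[OF local_dvd_diff local_dvd_sum[OF T_U]])
    show "local_dvd p 2 (of_int ?E)"
      unfolding local_dvd_of_int_iff by (intro dvd_diff A m_pow fact)
    show "local_dvd p 2 (of_int (int m) * D)"
      using local_dvd_mult[of 0 "of_int (int m)" 2 D] local_dvd_bernoulli_pred[OF \<open>odd p\<close>]
      unfolding D_def local_dvd_of_int_iff by (simp only: add_0 power_0 one_dvd)
  qed
  also have "of_int ?E - of_int (int m) * D - (\<Sum>l=1..p - 2. ?T l - ?U l)
      = of_nat p * (of_nat k * \<Sigma>) - of_int (int k ^ p + int k * fact (p - 1))"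
  proof -
    have "(of_nat m :: rat) = of_nat p - of_nat k"
      using assms by (simp add: m_def of_nat_diff)
    moreover have "(\<Sum>l=1..p - 2. ?T l - ?U l)
        = of_nat p * of_int A - of_nat m ^ p - of_nat p * bernoulli (p - 1) * of_nat m
          - of_nat p * (of_nat k * \<Sigma>)"
      unfolding sum_subtractf U_sum using T_sum by (simp add: algebra_simps)
    moreover have "P * (A - (M - 1)) - (M' + K') - P * (1 + F) - M * (P * B - (P + F)) - S
        = P * (K * s) - (K' + K * F)"
      if "M = P - K" "S = P * A - M' - P * B * M - P * (K * s)" for P A M M' K K' F B S s :: rat
      unfolding that by (simp add: algebra_simps)
    ultimately show ?thesis
      unfolding D_def of_int_diff of_int_add of_int_mult of_int_power of_int_of_nat_eq of_int_1 of_int_fact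
      by blast
  qed
  finally show ?thesis .
qed

text \<open>Multiplying by the unit \<open>k\<close> changes nothing, and multiplying by
  \<open>p\<close> raises the modulus to \<open>p ^ 2\<close>; then
  \<open>local_dvd_sum_bernoulli\<close> applies and a factor \<open>k\<close> cancels.\<close>

lemma rat_cong_sum_bernoulli_iff:
  assumes "odd p" "1 \<le> k" "k \<le> p - 1"
  shows "rat_cong p (\<Sum>l=1..p - 2. bernoulli l / (of_nat l * of_nat k ^ l)) 0
    \<longleftrightarrow> int p ^ 2 dvd int k ^ (p - 1) + fact (p - 1)"
proof -
  let ?\<Sigma> = "\<Sum>l=1..p - 2. bernoulli l / (of_nat l * of_nat k ^ l)"
  let ?a = "int k ^ p + int k * fact (p - 1)"
  have k: "\<not> p dvd k"
    using assms p_gt_1 by (auto dest!: dvd_imp_le)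
  have "rat_cong p ?\<Sigma> 0 \<longleftrightarrow> local_dvd p 1 (of_nat k * ?\<Sigma>)"
    using local_dvd_mult_unit_cancel[OF k, of 1 ?\<Sigma>] local_dvd_mult[of 0 "of_int (int k)" 1 ?\<Sigma>]
    unfolding rat_cong_0_iff local_dvd_of_int_iff by auto
  also have "\<dots> \<longleftrightarrow> local_dvd p 2 (of_nat p * (of_nat k * ?\<Sigma>))"
    by (simp only: numeral_2_eq_2 One_nat_def local_dvd_mult_p_cancel)
  also have "\<dots> \<longleftrightarrow> local_dvd p 2 (of_int ?a)"
    using local_dvd_sum_bernoulli[OF assms]
      local_dvd_diff[of 2 "of_nat p * (of_nat k * ?\<Sigma>)" "of_nat p * (of_nat k * ?\<Sigma>) - of_int ?a"]
      local_dvd_add[of 2 "of_nat p * (of_nat k * ?\<Sigma>) - of_int ?a" "of_int ?a"]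
    by auto
  also have "\<dots> \<longleftrightarrow> int p ^ 2 dvd int k * (int k ^ (p - 1) + fact (p - 1))"
  proof -
    have "?a = int k * (int k ^ (p - 1) + fact (p - 1))"
      using p_gt_1 by (cases p) (simp_all add: algebra_simps)
    then show ?thesis by (simp only: local_dvd_of_int_iff)
  qed
  also have "\<dots> \<longleftrightarrow> int p ^ 2 dvd int k ^ (p - 1) + fact (p - 1)"
  proof (rule coprime_dvd_mult_right_iff)
    show "coprime (int p ^ 2) (int k)"
      using k prime by (simp add: prime_imp_coprime)
  qed
  finally show ?thesis .
qed

text \<open>Hensel uniqueness at the second digit: replacing \<open>k\<close> by
  \<open>k + p * d\<close> changes the value modulo \<open>p ^ 2\<close> by \<open>p * d\<close>
  times the derivative \<open>(p - 1) * k ^ (p - 2)\<close>, a unit at \<open>p\<close>.\<close>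

lemma root_lift_iff:
  fixes d :: int
  assumes "\<not> p dvd k"
    and root: "int p ^ 2 dvd (int k + int p * d) ^ (p - 1) + c"
  shows "int p ^ 2 dvd int k ^ (p - 1) + c \<longleftrightarrow> int p dvd d"
proof -
  let ?e = "int (p - 1) * int k ^ (p - 1 - 1) * (int p * d)"
  have "int p ^ 2 dvd int k ^ (p - 1) + c + ?e"
  proof -
    have "int p ^ 2 dvd (int k + int p * d) ^ (p - 1) - (int k ^ (p - 1) + ?e)"
      using power_add_mult_cong_square[of "int k" "int p" d "p - 1"] by (simp add: cong_iff_dvd_diff)
    from dvd_diff[OF root this] show ?thesis by (simp add: algebra_simps)
  qed
  then have "int p ^ 2 dvd int k ^ (p - 1) + c \<longleftrightarrow> int p ^ 2 dvd ?e"
    by (metis dvd_add_right_iff dvd_add_left_iff)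
  also have "\<dots> \<longleftrightarrow> int p dvd int (p - 1) * int k ^ (p - 1 - 1) * d"
    using p_gt_1 by (simp add: power2_eq_square mult.left_commute)
  also have "\<dots> \<longleftrightarrow> int p dvd d"
  proof -
    have "\<not> int p dvd int (p - 1)" "\<not> int p dvd int k"
      using assms(1) p_gt_1 by (auto dest!: dvd_imp_le simp only: int_dvd_int_iff)
    then show ?thesis
      using prime_int by (auto simp only: prime_dvd_mult_iff dest: prime_dvd_power)
  qed
  finally show ?thesis .
qed

end

section \<open>Components of \<open>p\<close>-adic integers and the main theorem\<close>

lemma padic_nat_pow_apply:
  "(x [^]\<^bsub>padic_int p\<^esub> (m :: nat)) n mod int p ^ n = x n ^ m mod int p ^ n"
proof (induction m)
  case (Suc m)
  have "(x [^]\<^bsub>padic_int p\<^esub> Suc m) n = (x [^]\<^bsub>padic_int p\<^esub> m) n * x n mod int p ^ n"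
    by (simp add: nat_pow_def padic_int_def)
  with mod_mult_cong[OF Suc refl, of "x n"] show ?case
    by (simp only: mod_mod_trivial power_Suc2)
qed (simp add: nat_pow_def padic_int_def)

text \<open>Evaluates the images of \<open>k\<close>, \<open>p\<close> and
  \<open>fact (p - 1)\<close> in the ring; the outer \<open>mod\<close> lets it rewrite inside
  reduced expressions.\<close>

lemma padic_of_nat_apply:
  "([m] \<cdot>\<^bsub>padic_int p\<^esub> \<one>\<^bsub>padic_int p\<^esub>) n mod int p ^ n = int m mod int p ^ n"
proof (induction m)
  case (Suc m)
  have "([Suc m] \<cdot>\<^bsub>padic_int p\<^esub> \<one>\<^bsub>padic_int p\<^esub>) n
      = (([m] \<cdot>\<^bsub>padic_int p\<^esub> \<one>\<^bsub>padic_int p\<^esub>) n + 1 mod int p ^ n) mod int p ^ n"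
    by (simp add: add_pow_def nat_pow_def padic_int_def)
  with mod_add_cong[OF Suc refl, of 1] show ?case
    by (simp only: mod_simps mod_mod_trivial of_nat_Suc add.commute[of 1])
qed (simp add: add_pow_def nat_pow_def padic_int_def)

theorem theorem15:
  fixes p k :: nat and x :: "nat \<Rightarrow> int"
  assumes "prime p" and "odd p"
    and "1 \<le> k" and "k \<le> p - 1"
    and "x \<in> carrier (padic_int p)"
    and "x [^]\<^bsub>padic_int p\<^esub> (p - 1)
           \<oplus>\<^bsub>padic_int p\<^esub> [(fact (p - 1) :: nat)] \<cdot>\<^bsub>padic_int p\<^esub> \<one>\<^bsub>padic_int p\<^esub>
         = \<zero>\<^bsub>padic_int p\<^esub>"
    and "padic_cong p x ([k] \<cdot>\<^bsub>padic_int p\<^esub> \<one>\<^bsub>padic_int p\<^esub>)"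
  shows "rat_cong p (\<Sum>l = 1..p - 2. bernoulli l / (of_nat l * of_nat k ^ l)) 0
         \<longleftrightarrow> padic_digit p x 1 = 0"
proof -
  interpret prime_nat p by standard (rule assms)
  let ?d = "padic_digit p x 1"
  let ?f = "[(fact (p - 1) :: nat)] \<cdot>\<^bsub>padic_int p\<^esub> \<one>\<^bsub>padic_int p\<^esub>"
  let ?k = "[k] \<cdot>\<^bsub>padic_int p\<^esub> \<one>\<^bsub>padic_int p\<^esub>"
  \<comment> \<open>At level 1 the multiple of \<open>p\<close> in the congruence disappears, and
    \<open>k < p\<close> is its own residue.\<close>
  have "x 1 = int k"
  proof -
    obtain z where "x = ?k \<oplus>\<^bsub>padic_int p\<^esub> ([p] \<cdot>\<^bsub>padic_int p\<^esub> \<one>\<^bsub>padic_int p\<^esub>) \<otimes>\<^bsub>padic_int p\<^esub> z"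
      using assms(7) unfolding padic_cong_def by blast
    then have "x 1 = (?k 1 + ([p] \<cdot>\<^bsub>padic_int p\<^esub> \<one>\<^bsub>padic_int p\<^esub>) 1 * z 1 mod int p ^ 1) mod int p ^ 1"
      by (simp add: padic_int_def)
    also have "\<dots> = (?k 1 mod int p ^ 1 + (([p] \<cdot>\<^bsub>padic_int p\<^esub> \<one>\<^bsub>padic_int p\<^esub>) 1 mod int p ^ 1) * z 1 mod int p ^ 1) mod int p ^ 1"
      by (simp only: mod_simps)
    also have "\<dots> = int k mod int p"
      by (simp only: padic_of_nat_apply) (simp add: mod_simps)
    also have "\<dots> = int k"
      using assms(4) p_gt_1 by simp
    finally show ?thesis .
  qed
  then have x2: "x 2 = int k + int p * ?d"
    using padic_digit_sum[OF assms(5), of 1] padic_digit_sum[OF assms(5), of 2]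
    by (simp add: numeral_2_eq_2 mult.commute)
  \<comment> \<open>The root equation is read off at level 2, that is, modulo
    \<open>p ^ 2\<close>.\<close>
  have "(x 2 ^ (p - 1) + fact (p - 1)) mod int p ^ 2 = 0"
  proof -
    have "((x [^]\<^bsub>padic_int p\<^esub> (p - 1)) 2 + ?f 2) mod int p ^ 2 = 0"
      using fun_cong[OF assms(6), of 2] by (simp add: padic_int_def)
    then have "((x [^]\<^bsub>padic_int p\<^esub> (p - 1)) 2 mod int p ^ 2 + ?f 2 mod int p ^ 2) mod int p ^ 2 = 0"
      by (simp only: mod_simps)
    then show ?thesis
      by (simp only: padic_nat_pow_apply padic_of_nat_apply mod_simps of_nat_fact)
  qed
  then have "int p ^ 2 dvd (int k + int p * ?d) ^ (p - 1) + fact (p - 1)"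
    by (simp only: x2 mod_0_imp_dvd)
  then have "int p ^ 2 dvd int k ^ (p - 1) + fact (p - 1) \<longleftrightarrow> int p dvd ?d"
    using assms(3,4) p_gt_1 by (intro root_lift_iff) (auto dest!: dvd_imp_le)
  \<comment> \<open>A digit lies in \<open>{0..<p}\<close>, so divisibility by \<open>p\<close>
    forces it to be 0.\<close>
  also have "\<dots> \<longleftrightarrow> ?d = 0"
    using padic_digit_range[OF _ assms(5), of 1] p_gt_1 by (auto dest: zdvd_imp_le)
  finally show ?thesis
    using rat_cong_sum_bernoulli_iff[OF assms(2-4)] by simp
qed

end
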